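(* Let $k \geq 2$ be an integer. As formal power series, \begin{align*} \mathcal{FD}_k(z, q) := \sum_{j = 0}^\infty \sum_{n = 0}^\infty FD_{j, k}(n) z^j q^n &= \frac{q - (1 - z) q^k}{1 - 2q + (1 - z)q^{k + 1}}\\ &= \frac{q - q^k}{1 - 2q + q^{k + 1}} + (1 - q)^2 \sum_{j = 1}^\infty \frac{q^{jk + j - 1}}{(1 - 2q + q^{k + 1})^{j + 1}}z^j. \end{align*}
   Context: An integer partition is a weakly decreasing finite sequence $\mu = (\mu_1, \ldots, \mu_m)$ of positive integers (its parts); $\ell(\mu) := m$ is its length. The perimeter of a nonempty partition $\mu$ is $P(\mu) := \mu_1 + \ell(\mu) - 1$. The empty partition is not counted (so there are no partitions of perimeter $0$). $FD_{j,k}(n)$ is the number of partitions with perimeter $n$ having exactly $j$ distinct part sizes that appear at least $k$ times. *)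

theory Defs
  imports "HOL-Computational_Algebra.Formal_Power_Series"
begin

definition is_partition :: "nat list \<Rightarrow> bool" where
  "is_partition \<mu> \<longleftrightarrow> sorted_wrt (\<ge>) \<mu> \<and> (\<forall>p\<in>set \<mu>. 0 < p)"

text \<open>Only meaningful for nonempty partitions, where the first entry is the largest part.\<close>

definition perimeter :: "nat list \<Rightarrow> nat" where
  "perimeter \<mu> = hd \<mu> + length \<mu> - 1"

definition FD :: "nat \<Rightarrow> nat \<Rightarrow> nat \<Rightarrow> nat" where
  "FD j k n = card {\<mu>. is_partition \<mu> \<and> \<mu> \<noteq> [] \<and> perimeter \<mu> = n \<and>
                        card {p \<in> set \<mu>. k \<le> count_list \<mu> p} = j}"

text \<open>
  Power series in \<open>z\<close> and \<open>q\<close> are series in the outer variable \<open>z\<close> whose coefficients are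
  series in the inner variable \<open>q\<close>. The scalars are rational because the library's division
  of power series requires an inverse operation on scalars.
\<close>

abbreviation fps_z :: "rat fps fps" where
  "fps_z \<equiv> fps_X"

abbreviation fps_q :: "rat fps fps" where
  "fps_q \<equiv> fps_const fps_X"

definition FD_series :: "nat \<Rightarrow> rat fps fps" where
  "FD_series k = Abs_fps (\<lambda>j. Abs_fps (\<lambda>n. of_nat (FD j k n)))"

text \<open>
  The set counted by \<^const>\<open>FD\<close> is finite, so its cardinality is not the default value for
  infinite sets.
\<close>

lemma finite_partitions_perimeter:
  "finite {\<mu>. is_partition \<mu> \<and> \<mu> \<noteq> [] \<and> perimeter \<mu> = n}"
proof (rule finite_subset)
  show "{\<mu>. is_partition \<mu> \<and> \<mu> \<noteq> [] \<and> perimeter \<mu> = n}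
          \<subseteq> {\<mu>. set \<mu> \<subseteq> {..n} \<and> length \<mu> \<le> n}"
  proof clarify
    fix \<mu> assume *: "is_partition \<mu>" "\<mu> \<noteq> []" "n = perimeter \<mu>"
    then obtain a \<nu> where [simp]: "\<mu> = a # \<nu>" by (cases \<mu>) auto
    from * show "set \<mu> \<subseteq> {..perimeter \<mu>} \<and> length \<mu> \<le> perimeter \<mu>"
      by (fastforce simp: is_partition_def perimeter_def)
  qed
qed (rule finite_lists_length_le, simp)

text \<open>
  The library's division is total, also over coefficient rings such as \<^typ>\<open>rat fps\<close> that are
  not fields. For a denominator with nonzero constant term it is the true quotient.
\<close>

lemma fps_fps_divide_mult_cancel:
  fixes f g :: "rat fps fps"
  assumes "fps_nth (fps_nth g 0) 0 \<noteq> 0"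
  shows "f / g * g = f"
proof -
  have nz: "fps_nth g 0 \<noteq> 0" using assms by auto
  have "inverse (fps_nth g 0) * fps_nth g 0 = 1"
    using assms by (rule inverse_mult_eq_1)
  then have "inverse g * g = 1"
    by (metis fps_inverse_def fps_right_inverse mult.commute)
  then show ?thesis
    using nz by (simp add: fps_divide_unit mult.assoc)
qed

lemma denominators_nonzero_at_0:
  assumes "2 \<le> k"
  shows "fps_nth (fps_nth (1 - 2 * fps_q + (1 - fps_z) * fps_q ^ (k + 1)) 0) 0 \<noteq> 0"
    and "fps_nth (fps_nth ((1 - 2 * fps_q + fps_q ^ (k + 1)) ^ m) 0) 0 \<noteq> 0"
  by (simp_all add: fps_power_zeroth fps_numeral_nth_0)

end

theory Submission
  imports Defs
begin

text \<open>
  A nonempty partition with largest part \<open>m\<close> is a list of \<open>m\<close> multiplicities, for the part sizes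
  \<open>m, \<dots>, 1\<close>, whose first entry is positive; its perimeter is the length plus the sum of that
  list, minus one. One multiplicity has the generating function
  \<open>g = 1 + q + \<dots> + q^(k-1) + z (q^k + q^(k+1) + \<dots>) = (1 - (1 - z) q^k) / (1 - q)\<close>, so all
  multiplicity lists have the generating function \<open>S = 1 + q g S\<close>, and the partitions have
  \<open>(g - 1) S = (g - 1) / (1 - q g)\<close>. The second formula is the expansion of the first one as a
  geometric series in \<open>z\<close>.
\<close>

unbundle fps_syntax

subsection \<open>Partitions as lists of multiplicities\<close>

text \<open>Entries run from the largest part size down, so each size is the length of the remaining
  list. Leading zeros are allowed, so uniqueness needs a positive head.\<close>

fun partition_of_mults :: "nat list \<Rightarrow> nat list" where
  "partition_of_mults [] = []"
| "partition_of_mults (a # fs) = replicate a (Suc (length fs)) @ partition_of_mults fs"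

lemma set_partition_of_mults: "set (partition_of_mults fs) \<subseteq> {1..length fs}"
  by (induction fs) force+

lemma is_partition_of_mults: "is_partition (partition_of_mults fs)"
proof (induction fs)
  case (Cons a fs)
  have "sorted_wrt (\<ge>) (replicate a (Suc (length fs)))"
    by (induction a) auto
  with Cons set_partition_of_mults[of fs] show ?case
    by (force simp: is_partition_def sorted_wrt_append)
qed (simp add: is_partition_def)

lemma length_partition_of_mults: "length (partition_of_mults fs) = sum_list fs"
  by (induction fs) auto

lemma count_list_replicate: "count_list (replicate a x) y = (if x = y then a else 0)"
  by (induction a) auto

lemma count_list_partition_of_mults:
  "i < length fs \<Longrightarrow> count_list (partition_of_mults fs) (length fs - i) = fs ! i"
proof (induction fs arbitrary: i)
  case (Cons a fs)
  show ?case
  proof (cases i)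
    case 0
    have "Suc (length fs) \<notin> set (partition_of_mults fs)"
      using set_partition_of_mults[of fs] by force
    with 0 show ?thesis by (simp add: count_list_replicate)
  next
    case (Suc i')
    with Cons show ?thesis by (auto simp: count_list_replicate)
  qed
qed simp

lemma hd_partition_of_mults:
  assumes "fs \<noteq> []" "0 < hd fs"
  shows "partition_of_mults fs \<noteq> []" "hd (partition_of_mults fs) = length fs"
proof -
  from assms obtain a gs where "fs = Suc a # gs"
    by (cases fs) (auto simp: gr0_conv_Suc)
  then show "partition_of_mults fs \<noteq> []" "hd (partition_of_mults fs) = length fs" by auto
qed

text \<open>A positive head makes the length of the list equal to the largest part; the entries are
  then recovered as counts.\<close>

lemma inj_on_partition_of_mults: "inj_on partition_of_mults {fs. fs \<noteq> [] \<and> 0 < hd fs}"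
proof (rule inj_onI)
  fix fs gs
  assume *: "fs \<in> {fs. fs \<noteq> [] \<and> 0 < hd fs}" "gs \<in> {fs. fs \<noteq> [] \<and> 0 < hd fs}"
    and eq: "partition_of_mults fs = partition_of_mults gs"
  then have len: "length fs = length gs"
    by (metis (mono_tags) hd_partition_of_mults(2) mem_Collect_eq)
  show "fs = gs"
  proof (rule nth_equalityI)
    fix i assume "i < length fs"
    with len eq show "fs ! i = gs ! i"
      by (metis count_list_partition_of_mults)
  qed (fact len)
qed

text \<open>Here \<open>m\<close> is only an upper bound for the parts. A first part equal to the
  bound raises the leading multiplicity by one; if there is none, a leading 0 lowers the
  bound.\<close>

lemma ex_mults:
  assumes "is_partition \<mu>" "set \<mu> \<subseteq> {..m}"
  shows "\<exists>fs. length fs = m \<and> partition_of_mults fs = \<mu>"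
  using assms
proof (induction m arbitrary: \<mu>)
  case 0
  then show ?case by (cases \<mu>) (auto simp: is_partition_def)
next
  case (Suc m)
  from Suc.prems show ?case
  proof (induction \<mu>)
    case Nil
    obtain fs where "length fs = m" "partition_of_mults fs = []"
      using Suc.IH[of "[]"] by (auto simp: is_partition_def)
    then show ?case by (intro exI[of _ "0 # fs"]) simp
  next
    case (Cons p \<nu>)
    show ?case
    proof (cases "p = Suc m")
      case True
      have "is_partition \<nu>" "set \<nu> \<subseteq> {..Suc m}"
        using Cons.prems by (auto simp: is_partition_def)
      then obtain fs where fs: "length fs = Suc m" "partition_of_mults fs = \<nu>"
        using Cons.IH by blast
      then obtain a gs where "fs = a # gs" by (cases fs) auto
      with fs True show ?thesis by (intro exI[of _ "Suc a # gs"]) simp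
    next
      case False
      with Cons.prems have "set (p # \<nu>) \<subseteq> {..m}"
        by (force simp: is_partition_def)
      with Suc.IH Cons.prems obtain fs where "length fs = m" "partition_of_mults fs = p # \<nu>"
        by blast
      then show ?thesis by (intro exI[of _ "0 # fs"]) simp
    qed
  qed
qed

text \<open>Positivity of \<open>k\<close> excludes zero entries from the right-hand side, since
  their sizes do not occur in the partition.\<close>

lemma card_frequent_parts:
  assumes "0 < k"
  shows "card {p \<in> set (partition_of_mults fs). k \<le> count_list (partition_of_mults fs) p} =
           length (filter ((\<le>) k) fs)"
proof (induction fs)
  case (Cons a fs)
  let ?A = "\<lambda>fs. {p \<in> set (partition_of_mults fs). k \<le> count_list (partition_of_mults fs) p}"
  have notin: "Suc (length fs) \<notin> set (partition_of_mults fs)"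
    using set_partition_of_mults[of fs] by force
  with \<open>0 < k\<close> have "?A (a # fs) = (if k \<le> a then insert (Suc (length fs)) (?A fs) else ?A fs)"
    by (auto simp: count_list_replicate split: if_splits)
  moreover have "finite (?A fs)" by simp
  ultimately show ?case using Cons notin by simp
qed simp

definition mult_lists :: "nat \<Rightarrow> nat \<Rightarrow> nat \<Rightarrow> nat list set" where
  "mult_lists k j n = {fs. length fs + sum_list fs = n \<and> length (filter ((\<le>) k) fs) = j}"

lemma FD_eq_card_mult_lists:
  assumes "0 < k"
  shows "FD j k n = card {fs \<in> mult_lists k j (Suc n). fs \<noteq> [] \<and> hd fs \<in> {0<..}}"
proof -
  let ?B = "{fs \<in> mult_lists k j (Suc n). fs \<noteq> [] \<and> hd fs \<in> {0<..}}"
  let ?C = "{\<mu>. is_partition \<mu> \<and> \<mu> \<noteq> [] \<and> perimeter \<mu> = n \<and>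
              card {p \<in> set \<mu>. k \<le> count_list \<mu> p} = j}"
  have "inj_on partition_of_mults ?B"
    using inj_on_partition_of_mults by (rule inj_on_subset) auto
  moreover have "partition_of_mults ` ?B = ?C"
  proof (intro equalityI subsetI)
    fix \<mu> assume "\<mu> \<in> partition_of_mults ` ?B"
    then show "\<mu> \<in> ?C"
      using assms by (auto simp: mult_lists_def perimeter_def is_partition_of_mults
          hd_partition_of_mults length_partition_of_mults card_frequent_parts)
  next
    fix \<mu> assume mu: "\<mu> \<in> ?C"
    then obtain p \<nu> where mu_eq: "\<mu> = p # \<nu>" by (cases \<mu>) auto
    with mu have "set \<mu> \<subseteq> {..p}" "0 < p" by (auto simp: is_partition_def)
    with mu obtain fs where fs: "length fs = p" "partition_of_mults fs = \<mu>"
      using ex_mults by blast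
    with \<open>0 < p\<close> obtain a gs where gs: "fs = a # gs" by (cases fs) auto
    \<comment> \<open>With a zero head, all parts would come from \<open>gs\<close> and be smaller
      than \<open>p\<close>.\<close>
    have "0 < a"
    proof (rule ccontr)
      assume "\<not> 0 < a"
      with fs gs mu_eq have "p \<in> set (partition_of_mults gs)" by auto
      with set_partition_of_mults[of gs] fs gs show False by auto
    qed
    moreover have "Suc (perimeter \<mu>) = length fs + sum_list fs"
      using fs mu_eq \<open>0 < p\<close> by (simp add: perimeter_def flip: length_partition_of_mults)
    ultimately have "fs \<in> ?B"
      using mu fs gs card_frequent_parts[OF assms, of fs] by (auto simp: mult_lists_def)
    with fs show "\<mu> \<in> partition_of_mults ` ?B" by blast
  qed
  ultimately have "bij_betw partition_of_mults ?B ?C"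
    by (simp add: bij_betw_def)
  then show ?thesis
    unfolding FD_def by (simp only: bij_betw_same_card)
qed

subsection \<open>Generating functions\<close>

text \<open>The generating function of a single entry restricted to \<open>A\<close>. For
  \<open>UNIV\<close> it is the series \<open>g\<close> of the overview, for \<open>{0<..}\<close>
  the series \<open>g - 1\<close>.\<close>

definition mult_series :: "nat \<Rightarrow> nat set \<Rightarrow> rat fps fps" where
  "mult_series k A = Abs_fps (\<lambda>j. Abs_fps (\<lambda>a. of_bool (a \<in> A \<and> j = of_bool (k \<le> a))))"

definition mult_list_series :: "nat \<Rightarrow> rat fps fps" where
  "mult_list_series k = Abs_fps (\<lambda>j. Abs_fps (\<lambda>n. of_nat (card (mult_lists k j n))))"

lemma finite_mult_lists: "finite (mult_lists k j n)"
proof (rule finite_subset)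
  show "mult_lists k j n \<subseteq> {fs. set fs \<subseteq> {..n} \<and> length fs \<le> n}"
    using member_le_sum_list by (fastforce simp: mult_lists_def)
qed (rule finite_lists_length_le, simp)

lemma fps_fps_mult_nth:
  fixes f g :: "'a::comm_semiring_1 fps fps"
  shows "(f * g) $ j $ n = (\<Sum>a\<le>n. \<Sum>i\<le>j. f $ i $ a * g $ (j - i) $ (n - a))"
  by (simp add: fps_mult_nth fps_sum_nth atLeast0AtMost) (rule sum.swap)

text \<open>A nonempty list splits into head and tail. The shift to \<open>Suc n\<close> arises
  because \<open>mult_series\<close> records the value of the head but not its unit of
  length.\<close>

lemma mult_series_mult_list_series:
  "mult_series k A * mult_list_series k =
     Abs_fps (\<lambda>j. Abs_fps (\<lambda>n.
       of_nat (card {fs \<in> mult_lists k j (Suc n). fs \<noteq> [] \<and> hd fs \<in> A})))"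
proof (intro fps_ext)
  fix j n
  \<comment> \<open>\<open>T a\<close> collects the lists with head \<open>a\<close>. The guard
    against \<open>j\<close> is needed because truncated subtraction would otherwise admit frequent
    heads when \<open>j = 0\<close>.\<close>
  define T where "T a = (if a \<in> A \<and> of_bool (k \<le> a) \<le> j
    then (#) a ` mult_lists k (j - of_bool (k \<le> a)) (n - a) else {})" for a
  have "{fs \<in> mult_lists k j (Suc n). fs \<noteq> [] \<and> hd fs \<in> A} = (\<Union>a\<le>n. T a)"
  proof (intro equalityI subsetI)
    fix fs assume *: "fs \<in> {fs \<in> mult_lists k j (Suc n). fs \<noteq> [] \<and> hd fs \<in> A}"
    then obtain a gs where "fs = a # gs" by (cases fs) auto
    with * have "a \<le> n" "fs \<in> T a" by (auto simp: T_def mult_lists_def)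
    then show "fs \<in> (\<Union>a\<le>n. T a)" by blast
  qed (auto simp: T_def mult_lists_def split: if_splits)
  then have card: "card {fs \<in> mult_lists k j (Suc n). fs \<noteq> [] \<and> hd fs \<in> A} = (\<Sum>a\<le>n. card (T a))"
    by (subst card_UN_disjoint[symmetric]) (auto simp: T_def finite_mult_lists)
  have "of_nat (card (T a)) =
    (\<Sum>i\<le>j. mult_series k A $ i $ a * mult_list_series k $ (j - i) $ (n - a))" for a
  proof -
    have "(\<Sum>i\<le>j. mult_series k A $ i $ a * mult_list_series k $ (j - i) $ (n - a)) =
      (\<Sum>i\<le>j. if i = of_bool (k \<le> a)
         then of_bool (a \<in> A) * mult_list_series k $ (j - i) $ (n - a) else 0)"
      by (intro sum.cong) (auto simp: mult_series_def)
    then show ?thesis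
      by (auto simp: T_def card_image mult_list_series_def)
  qed
  then show "(mult_series k A * mult_list_series k) $ j $ n =
    Abs_fps (\<lambda>j. Abs_fps (\<lambda>n.
       of_nat (card {fs \<in> mult_lists k j (Suc n). fs \<noteq> [] \<and> hd fs \<in> A}))) $ j $ n"
    unfolding fps_nth_Abs_fps card of_nat_sum fps_fps_mult_nth by simp
qed

text \<open>A list is empty or has a head; the factor \<open>fps_q\<close> restores the unit of
  length of the head.\<close>

lemma mult_list_series_eq:
  "mult_list_series k = 1 + fps_q * (mult_series k UNIV * mult_list_series k)"
proof (intro fps_ext)
  fix j n
  show "mult_list_series k $ j $ n =
    (1 + fps_q * (mult_series k UNIV * mult_list_series k)) $ j $ n"
  proof (cases n)
    case 0
    have "mult_lists k j 0 = (if j = 0 then {[]} else {})"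
      by (auto simp: mult_lists_def)
    with 0 show ?thesis by (simp add: mult_list_series_def)
  next
    case (Suc n')
    have "{fs \<in> mult_lists k j (Suc n'). fs \<noteq> [] \<and> hd fs \<in> UNIV} = mult_lists k j (Suc n')"
      by (auto simp: mult_lists_def)
    then have "(mult_series k UNIV * mult_list_series k) $ j $ n' = mult_list_series k $ j $ n"
      unfolding mult_series_mult_list_series using Suc by (simp add: mult_list_series_def)
    with Suc show ?thesis by simp
  qed
qed

lemma FD_series_eq:
  assumes "0 < k"
  shows "FD_series k = mult_series k {0<..} * mult_list_series k"
  using assms
  by (simp add: FD_series_def mult_series_mult_list_series FD_eq_card_mult_lists)

text \<open>Multiplying by \<open>1 - fps_q\<close> takes differences of consecutive coefficients in
  \<open>q\<close>, which can be nonzero only at 0 and \<open>k\<close>.\<close>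

lemma mult_series_UNIV:
  "(1 - fps_q) * mult_series k UNIV = 1 - (1 - fps_z) * fps_q ^ k"
proof (intro fps_ext)
  fix j n
  show "((1 - fps_q) * mult_series k UNIV) $ j $ n = (1 - (1 - fps_z) * fps_q ^ k) $ j $ n"
    by (cases n; cases j)
      (auto simp: mult_series_def algebra_simps fps_X_power_nth fps_const_power le_Suc_eq)
qed

lemma mult_series_positive:
  assumes "0 < k"
  shows "mult_series k {0<..} = mult_series k UNIV - 1"
proof (intro fps_ext)
  fix j n
  show "mult_series k {0<..} $ j $ n = (mult_series k UNIV - 1) $ j $ n"
    using assms by (cases n; cases j) (auto simp: mult_series_def)
qed

lemma FD_series_mult:
  assumes "0 < k"
  shows "FD_series k * (1 - 2 * fps_q + (1 - fps_z) * fps_q ^ (k + 1)) =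
           fps_q - (1 - fps_z) * fps_q ^ k"
proof -
  define g where "g = mult_series k UNIV"
  define S where "S = mult_list_series k"
  have g: "(1 - fps_q) * g = 1 - (1 - fps_z) * fps_q ^ k"
    unfolding g_def by (rule mult_series_UNIV)
  have S: "S * (1 - fps_q * g) = 1"
    using mult_list_series_eq[of k] by (simp add: g_def S_def algebra_simps)
  \<comment> \<open>With \<open>y\<close> in place of \<open>fps_q ^ k\<close> the identity is
    polynomial and within reach of \<open>algebra\<close>.\<close>
  have *: "1 - 2 * q + (1 - z) * (y * q) = (1 - q) * (1 - q * h)"
    if "(1 - q) * h = 1 - (1 - z) * y" for q h y z :: "rat fps fps"
    using that by algebra
  have denominator:
    "1 - 2 * fps_q + (1 - fps_z) * fps_q ^ (k + 1) = (1 - fps_q) * (1 - fps_q * g)"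
    using *[OF g] unfolding power_add power_one_right .
  have "FD_series k * (1 - 2 * fps_q + (1 - fps_z) * fps_q ^ (k + 1)) =
    (1 - fps_q) * (g - 1) * (S * (1 - fps_q * g))"
    unfolding denominator using assms
    by (simp add: FD_series_eq mult_series_positive g_def S_def ac_simps)
  also have "\<dots> = (1 - fps_q) * (g - 1)"
    using S by simp
  also have "\<dots> = fps_q - (1 - fps_z) * fps_q ^ k"
    unfolding right_diff_distrib g by simp
  finally show ?thesis .
qed

subsection \<open>Expansion in powers of \<open>z\<close>\<close>

lemma fps_fps_divide_eqI:
  fixes f g h :: "rat fps fps"
  assumes "g $ 0 $ 0 \<noteq> 0" "h * g = f"
  shows "f / g = h"
proof -
  have "f / g * g = h * g"
    using fps_fps_divide_mult_cancel[OF assms(1)] assms(2) by simp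
  moreover have "g \<noteq> 0" using assms(1) by auto
  ultimately show ?thesis by simp
qed

lemma fps_fps_divide_const:
  fixes f :: "rat fps fps"
  assumes "d $ 0 \<noteq> 0"
  shows "f / fps_const d = f * fps_const (inverse d)"
  using assms
  by (intro fps_fps_divide_eqI)
    (simp_all add: mult.assoc inverse_mult_eq_1 fps_const_mult)

text \<open>Turns the sum over \<open>j \<ge> 1\<close> into a series indexed from 0: the constant
  coefficient vanishes, so the partial sums only shift by one.\<close>

lemma sums_fps_X_power_Suc:
  fixes a :: "nat \<Rightarrow> 'a::comm_ring_1"
  shows "(\<lambda>i. fps_const (a i) * fps_X ^ Suc i) sums (fps_X * Abs_fps a)"
proof -
  let ?G = "fps_X * Abs_fps a"
  have "(\<lambda>n. \<Sum>i\<le>n. fps_const (?G $ i) * fps_X ^ i) \<longlonglongrightarrow> ?G"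
    using fps_notation[of ?G] by (simp add: atLeast0AtMost)
  moreover have "(\<Sum>i\<le>n. fps_const (?G $ i) * fps_X ^ i) =
    (\<Sum>i<n. fps_const (a i) * fps_X ^ Suc i)" for n
    by (simp add: sum.atMost_shift del: power_Suc)
  ultimately show ?thesis by (simp add: sums_def del: power_Suc)
qed

theorem proposition3p1:
  fixes k :: nat
  assumes "2 \<le> k"
  shows "FD_series k =
           (fps_q - (1 - fps_z) * fps_q ^ k) /
           (1 - 2 * fps_q + (1 - fps_z) * fps_q ^ (k + 1)) \<and>
         summable (\<lambda>i. let j = i + 1 in
           fps_q ^ (j * k + j - 1) / (1 - 2 * fps_q + fps_q ^ (k + 1)) ^ (j + 1) * fps_z ^ j) \<and>
         (fps_q - (1 - fps_z) * fps_q ^ k) /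
           (1 - 2 * fps_q + (1 - fps_z) * fps_q ^ (k + 1)) =
         (fps_q - fps_q ^ k) / (1 - 2 * fps_q + fps_q ^ (k + 1)) +
         (1 - fps_q)\<^sup>2 *
           (\<Sum>i. let j = i + 1 in
              fps_q ^ (j * k + j - 1) / (1 - 2 * fps_q + fps_q ^ (k + 1)) ^ (j + 1) * fps_z ^ j)"
proof -
  \<comment> \<open>\<open>d\<close> is the denominator \<open>D\<close> at \<open>z = 0\<close>,
    and \<open>a i\<close> is the coefficient of \<open>z^j\<close> in the sum for
    \<open>j = i + 1\<close>, where \<open>j * k + j - 1 = i * (k + 1) + k\<close>.\<close>
  define d :: "rat fps" where "d = 1 - 2 * fps_X + fps_X ^ (k + 1)"
  define D where "D = 1 - 2 * fps_q + (1 - fps_z) * fps_q ^ (k + 1)"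
  define V where "V = fps_const (inverse d)"
  define a where "a i = fps_X ^ (i * (k + 1) + k) * inverse d ^ (i + 2)" for i
  define G where "G = fps_z * Abs_fps a"
  define t where "t i = (let j = i + 1 in
    fps_q ^ (j * k + j - 1) / (1 - 2 * fps_q + fps_q ^ (k + 1)) ^ (j + 1) * fps_z ^ j)" for i
  have d0: "d $ 0 = 1" by (simp add: d_def)
  have dV: "fps_const d * V = 1"
    unfolding V_def using d0 by (simp add: inverse_mult_eq_1' fps_const_mult)
  have d_eq: "1 - 2 * fps_q + fps_q ^ (k + 1) = fps_const d"
    by (simp add: d_def fps_const_power numeral_fps_const fps_const_mult
        flip: fps_const_1_eq_1 fps_const_sub fps_const_add)
  have D_eq: "D = fps_const d - fps_z * fps_q ^ (k + 1)"
    unfolding D_def d_eq[symmetric] by (simp add: algebra_simps)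
  have D0: "D $ 0 $ 0 \<noteq> 0"
    unfolding D_def by (rule denominators_nonzero_at_0(1)[OF assms])
  have t_eq: "t i = fps_const (a i) * fps_X ^ Suc i" for i
  proof -
    have "(i + 1) * k + (i + 1) - 1 = i * (k + 1) + k" by (simp add: algebra_simps)
    moreover have "(d ^ (i + 1 + 1)) $ 0 \<noteq> 0" using d0 by (simp add: fps_power_zeroth)
    moreover have "inverse (d ^ m) = inverse d ^ m" for m by (simp add: fps_inverse_power)
    ultimately show ?thesis
      unfolding t_def Let_def d_eq
      by (simp add: fps_const_power fps_fps_divide_const a_def fps_const_mult ac_simps del: power_Suc)
  qed
  have sums: "t sums G"
    unfolding t_eq G_def by (rule sums_fps_X_power_Suc)
  have *: "(z * A) * (e - z * x) = z * y * v" if "e * v = 1" "A = y * v ^ 2 + z * x * v * A"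
    for A e v x y z :: "rat fps fps"
    using that by algebra
  \<comment> \<open>The coefficients \<open>a i\<close> are geometric with ratio
    \<open>q^(k+1) / d\<close>, starting at \<open>q^k / d^2\<close>.\<close>
  have "Abs_fps a = fps_q ^ k * V ^ 2 + fps_z * fps_q ^ (k + 1) * V * Abs_fps a"
  proof (rule fps_ext)
    fix i
    show "Abs_fps a $ i = (fps_q ^ k * V ^ 2 + fps_z * fps_q ^ (k + 1) * V * Abs_fps a) $ i"
      by (cases i) (simp_all add: a_def V_def fps_const_power fps_const_mult
          power_add ac_simps power2_eq_square)
  qed
  then have G: "G * D = fps_z * fps_q ^ k * V"
    unfolding G_def D_eq by (rule *[OF dV])
  have "((fps_q - fps_q ^ k) * V + (1 - fps_q)\<^sup>2 * G) * D = fps_q - (1 - fps_z) * fps_q ^ k"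
  proof -
    \<comment> \<open>The terms with \<open>z\<close> collect to
      \<open>z * y * v * ((1 - q)^2 - q * (q - y))\<close>; the last factor equals \<open>e\<close>,
      which cancels \<open>v\<close>.\<close>
    have "((q - y) * v + (1 - q)\<^sup>2 * g) * c = q - (1 - z) * y"
      if "e = 1 - 2 * q + y * q" "e * v = 1" "g * c = z * y * v" "c = e - z * (y * q)"
      for q y v g z c e :: "rat fps fps"
      using that by algebra
    moreover have "fps_const d = 1 - 2 * fps_q + fps_q ^ k * fps_q"
      unfolding d_eq[symmetric] by (simp only: power_add power_one_right)
    ultimately show ?thesis
      using dV G D_eq unfolding power_add power_one_right by blast
  qed
  then have "(fps_q - (1 - fps_z) * fps_q ^ k) / D =
      (fps_q - fps_q ^ k) * V + (1 - fps_q)\<^sup>2 * G"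
    by (rule fps_fps_divide_eqI[OF D0])
  also have "(fps_q - fps_q ^ k) * V = (fps_q - fps_q ^ k) / (1 - 2 * fps_q + fps_q ^ (k + 1))"
    using d0 unfolding d_eq V_def by (subst fps_fps_divide_const) simp_all
  also have "G = (\<Sum>i. t i)"
    using sums by (rule sums_unique)
  finally have "(fps_q - (1 - fps_z) * fps_q ^ k) / D =
      (fps_q - fps_q ^ k) / (1 - 2 * fps_q + fps_q ^ (k + 1)) + (1 - fps_q)\<^sup>2 * (\<Sum>i. t i)" .
  moreover have "FD_series k = (fps_q - (1 - fps_z) * fps_q ^ k) / D"
    using FD_series_mult[of k] assms D0
    by (intro fps_fps_divide_eqI[symmetric]) (simp_all add: D_def)
  ultimately show ?thesis
    using sums_summable[OF sums] unfolding t_def D_def by blast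
qed

end
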